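(* There is a function $\varepsilon:\mathbb{N}\to\mathbb{R}$ with $\varepsilon(k)\to 0$ as $k\to\infty$ such that for all integers $k\ge 1$ and $n$ with $k<n/2$, $$\operatorname{coind}_{\mathbb{Z}_2}\bigl(S(\mathrm{GHD}_k^n)\bigr)\ \ge\ (1-\varepsilon(k))\cdot 2k .$$
   Context: For integers $k<n/2$, $\mathrm{GHD}_k^n$ is the partial sign matrix with rows and columns indexed by $\{0,1\}^n$, given by $\mathrm{GHD}_k^n(x,y)=1$ if $d_H(x,y)\le k$, $-1$ if $d_H(x,y)\ge n-k$, and $*$ otherwise, where $d_H$ is Hamming distance. Sign complex. For a partial sign matrix $A\in\{-1,1,*\}^{M\times N}$ and each row $r$ of $A$, let $\sigma_r^+=\{i^+: r_i=+1\}\cup\{i^-: r_i=-1\}$ and $\sigma_r^-=\{i^-: r_i=+1\}\cup\{i^+: r_i=-1\}$, where $i$ ranges over column indices and $i^+,i^-$ are two disjoint copies of the column index $i$. The sign complex $S(A)$ is the abstract simplicial complex whose simplices are all subsets of $\sigma_r^+$ or $\sigma_r^-$ over all rows $r$. The involution $i^+\leftrightarrow i^-$ is a free simplicial $\mathbb{Z}_2$-action on $S(A)$, inducing a free action on the geometric realization $|S(A)|$. Coindex. For a free $\mathbb{Z}_2$-complex $K$, $\operatorname{coind}_{\mathbb{Z}_2}(K)$ is the maximum $d\ge 0$ for which there is a continuous $\mathbb{Z}_2$-equivariant map $\mathbb{S}^d\to|K|$, where $\mathbb{S}^d$ carries the antipodal action. *)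

theory Defs
  imports "HOL-Analysis.Analysis" "HOL-Library.Extended_Real"
begin

section \<open>Simplicial complexes with an involution\<close>

definition abstract_simplicial_complex :: "'v set set \<Rightarrow> bool" where
  "abstract_simplicial_complex K \<longleftrightarrow>
     (\<forall>s\<in>K. finite s) \<and> (\<forall>s\<in>K. \<forall>t. t \<subseteq> s \<longrightarrow> t \<in> K)"

text \<open>Points of the realization are given by barycentric coordinates. A complex contains the
  empty simplex, but the coordinates sum to 1, so no point has empty support.\<close>

definition realization_points :: "'v set set \<Rightarrow> ('v \<Rightarrow> real) set" where
  "realization_points K =
     {x. (\<forall>v. 0 \<le> x v) \<and> {v. x v \<noteq> 0} \<in> K \<and> (\<Sum>v | x v \<noteq> 0. x v) = 1}"

text \<open>The topology is the subspace topology of a product of real lines. This is the usual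
  topology of the realization when \<open>K\<close> has finitely many vertices, which is the only
  case of interest here.\<close>

definition realization :: "'v set set \<Rightarrow> ('v \<Rightarrow> real) topology" where
  "realization K = subtopology (powertop_real UNIV) (realization_points K)"

text \<open>The map induced by a vertex map \<open>\<tau>\<close> sends \<open>x\<close> to the point
  whose coordinate at \<open>\<tau> v\<close> is \<open>x v\<close>. For an involution \<open>\<tau>\<close> this is
  \<open>x \<circ> \<tau>\<close>.\<close>

definition induced_action :: "('v \<Rightarrow> 'v) \<Rightarrow> ('v \<Rightarrow> real) \<Rightarrow> ('v \<Rightarrow> real)" where
  "induced_action \<tau> x = x \<circ> \<tau>"

definition free_Z2_complex :: "'v set set \<Rightarrow> ('v \<Rightarrow> 'v) \<Rightarrow> bool" where
  "free_Z2_complex K \<tau> \<longleftrightarrow>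
     finite K \<and> abstract_simplicial_complex K \<and>
     (\<forall>v. \<tau> (\<tau> v) = v) \<and> (\<forall>s\<in>K. \<tau> ` s \<in> K) \<and>
     (\<forall>x\<in>realization_points K. induced_action \<tau> x \<noteq> x)"

definition equivariant_sphere_map ::
    "nat \<Rightarrow> 'v set set \<Rightarrow> ('v \<Rightarrow> 'v) \<Rightarrow> ((nat \<Rightarrow> real) \<Rightarrow> ('v \<Rightarrow> real)) \<Rightarrow> bool" where
  "equivariant_sphere_map d K \<tau> f \<longleftrightarrow>
     continuous_map (nsphere d) (realization K) f \<and>
     (\<forall>x\<in>topspace (nsphere d). f (\<lambda>i. - x i) = induced_action \<tau> (f x))"

text \<open>The supremum is taken in the extended naturals. It is the maximum whenever the set of
  admissible \<open>d\<close> is nonempty and bounded (lemma \<open>coind_Z2_eq_maximum\<close> below), and this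
  is the case for every finite free complex with a vertex by the Borsuk--Ulam theorem.\<close>

definition coind_Z2 :: "'v set set \<Rightarrow> ('v \<Rightarrow> 'v) \<Rightarrow> enat" where
  "coind_Z2 K \<tau> = Sup {enat d | d. \<exists>f. equivariant_sphere_map d K \<tau> f}"

lemma coind_Z2_eq_maximum:
  assumes "\<exists>f. equivariant_sphere_map d K \<tau> f"
    and "\<And>e f. equivariant_sphere_map e K \<tau> f \<Longrightarrow> e \<le> d"
  shows "coind_Z2 K \<tau> = enat d"
  unfolding coind_Z2_def
  by (rule Sup_eqI) (use assms in auto)


section \<open>Partial sign matrices and their sign complexes\<close>

datatype sign_entry = Plus | Minus | Star

type_synonym ('r, 'c) partial_sign_matrix = "'r \<Rightarrow> 'c \<Rightarrow> sign_entry"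

text \<open>The index sets \<open>M\<close> of rows and \<open>N\<close> of columns are passed explicitly. The copies
  \<open>i\<^sup>+\<close> and \<open>i\<^sup>-\<close> of a column index \<open>i\<close> are \<open>Inl i\<close> and
  \<open>Inr i\<close>.\<close>

definition sigma_plus ::
    "'c set \<Rightarrow> ('r, 'c) partial_sign_matrix \<Rightarrow> 'r \<Rightarrow> ('c + 'c) set" where
  "sigma_plus N A r = {Inl i | i. i \<in> N \<and> A r i = Plus} \<union> {Inr i | i. i \<in> N \<and> A r i = Minus}"

definition sigma_minus ::
    "'c set \<Rightarrow> ('r, 'c) partial_sign_matrix \<Rightarrow> 'r \<Rightarrow> ('c + 'c) set" where
  "sigma_minus N A r = {Inr i | i. i \<in> N \<and> A r i = Plus} \<union> {Inl i | i. i \<in> N \<and> A r i = Minus}"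

definition sign_complex ::
    "'r set \<Rightarrow> 'c set \<Rightarrow> ('r, 'c) partial_sign_matrix \<Rightarrow> ('c + 'c) set set" where
  "sign_complex M N A = {s. \<exists>r\<in>M. s \<subseteq> sigma_plus N A r \<or> s \<subseteq> sigma_minus N A r}"

definition swap_sign :: "'c + 'c \<Rightarrow> 'c + 'c" where
  "swap_sign = case_sum Inr Inl"

lemma swap_sign_simps [simp]:
  "swap_sign (Inl i) = Inr i" "swap_sign (Inr i) = Inl i" "swap_sign (swap_sign v) = v"
  by (cases v; simp add: swap_sign_def)+

lemma swap_sign_sigma:
  "swap_sign ` sigma_plus N A r = sigma_minus N A r"
  "swap_sign ` sigma_minus N A r = sigma_plus N A r"
  by (force simp: sigma_plus_def sigma_minus_def image_iff)+

lemma free_Z2_complex_sign_complex: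
  assumes "finite M" "finite N"
  shows "free_Z2_complex (sign_complex M N A) swap_sign"
proof -
  let ?K = "sign_complex M N A"
  have sub: "?K \<subseteq> Pow (N <+> N)"
    by (auto simp: sign_complex_def sigma_plus_def sigma_minus_def)
  have fin: "finite (N <+> N)"
    using assms by simp
  have "finite ?K"
    using finite_subset[OF sub] fin by simp
  moreover have "abstract_simplicial_complex ?K"
    unfolding abstract_simplicial_complex_def
  proof (intro conjI ballI allI impI)
    show "finite s" if "s \<in> ?K" for s
      using that sub fin by (meson PowD finite_subset subsetD)
    show "t \<in> ?K" if "s \<in> ?K" "t \<subseteq> s" for s t
      using that unfolding sign_complex_def by blast
  qed
  moreover have "swap_sign ` s \<in> ?K" if "s \<in> ?K" for s
    using that image_mono[of s _ swap_sign] unfolding sign_complex_def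
    by (auto) (metis swap_sign_sigma)+
  moreover have "induced_action swap_sign x \<noteq> x" if x: "x \<in> realization_points ?K" for x
  proof
    assume eq: "induced_action swap_sign x = x"
    have "{v. x v \<noteq> 0} \<noteq> {}"
    proof
      assume "{v. x v \<noteq> 0} = {}"
      then show False using x by (auto simp: realization_points_def)
    qed
    then obtain v where v: "x v \<noteq> 0" by blast
    have "x (swap_sign v) = x v"
      using eq by (metis comp_apply induced_action_def)
    moreover obtain r where
      "{v. x v \<noteq> 0} \<subseteq> sigma_plus N A r \<or> {v. x v \<noteq> 0} \<subseteq> sigma_minus N A r"
      using x by (auto simp: realization_points_def sign_complex_def)
    ultimately have
      "{v, swap_sign v} \<subseteq> sigma_plus N A r \<or> {v, swap_sign v} \<subseteq> sigma_minus N A r"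
      using v by (metis (mono_tags, lifting) empty_subsetI insert_subset mem_Collect_eq subsetD)
    then show False
      by (cases v) (auto simp: sigma_plus_def sigma_minus_def)
  qed
  ultimately show ?thesis
    by (simp add: free_Z2_complex_def)
qed


section \<open>The gap Hamming distance matrix\<close>

definition cube :: "nat \<Rightarrow> bool list set" where
  "cube n = {x. length x = n}"

definition hamming_dist :: "bool list \<Rightarrow> bool list \<Rightarrow> nat" where
  "hamming_dist x y = card {i. i < length x \<and> x ! i \<noteq> y ! i}"

definition GHD :: "nat \<Rightarrow> nat \<Rightarrow> (bool list, bool list) partial_sign_matrix" where
  "GHD k n x y =
     (if hamming_dist x y \<le> k then Plus
      else if hamming_dist x y \<ge> n - k then Minus
      else Star)"

end

theory Submission
  imports Defs
begin

text \<open>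
  The proof gives the bound \<open>2 * k\<close> for the coindex, so \<open>\<epsilon> = 0\<close> works. Put
  \<open>d = 2 * k < n\<close>.

  A point \<open>x\<close> of the \<open>d\<close>-sphere is read as the coefficient vector of a nonzero polynomial of
  degree at most \<open>d\<close>, and its values at \<open>0, \<dots>, n - 1\<close> form a vector \<open>y\<close> with at most \<open>d\<close>
  zeros. Hence there is a positive window \<open>h\<close>, continuous and even in \<open>x\<close>, such that
  \<open>\<bar>y j\<bar> < h\<close> for at most \<open>d\<close> indices \<open>j\<close> (\<open>card_window\<close>, \<open>window_pos\<close>). Now pick a
  threshold \<open>t\<close> uniformly in \<open>[-h, h)\<close>. The random set \<open>{j. t < y j}\<close> is a random vertex of
  the cube, and its distribution depends continuously on \<open>x\<close>. Replacing \<open>x\<close> by \<open>- x\<close> replaces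
  the random vertex by its antipode, up to a null set of thresholds. Geometrically, \<open>y\<close> is
  truncated to a point of the \<open>d\<close>-skeleton of the cube \<open>[-h, h]\<^sup>n\<close>, and the distribution
  consists of its barycentric coordinates in the Kuhn triangulation, which is antipodally
  symmetric.

  The vertices that occur for one \<open>x\<close> agree outside the at most \<open>2 * k\<close> indices in the window.
  They all lie in a Hamming ball of radius \<open>k\<close> around a vertex of the cube: split the indices in
  the window into at most \<open>k\<close> blocks, all pairs except for one single index if their number is
  odd, and let
  the centre contain, from each pair, the index with the larger value. A threshold set can
  disagree with this choice at only one index of each pair (\<open>pairing_centre\<close>, \<open>threshold_support_in_ball\<close>).

  Finally, a vertex \<open>u\<close> of the cube is represented in the sign complex by \<open>u\<^sup>+\<close>, and also by
  the negative copy of its antipode, because a row is within distance \<open>k\<close> of \<open>u\<close> iff it is at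
  distance at least \<open>n - k\<close> from the antipode. Giving half of the mass to each representative
  makes the map equivariant by construction (\<open>equivariant_sphere_map_GHD\<close>).
\<close>

section \<open>Threshold sets and a common Hamming centre\<close>

text \<open>Take two elements of \<open>S\<close> and let \<open>R\<close> contain the one with the larger value but not the
  other. A threshold set differs from \<open>R\<close> at the larger one only if both values are at most
  \<open>t\<close>, and at the smaller one only if both exceed \<open>t\<close>. So each pair contributes at most
  one disagreement, for every \<open>t\<close> at once.\<close>

lemma pairing_centre:
  fixes y :: "'a \<Rightarrow> real"
  assumes "finite S" and "card S \<le> 2 * k"
  shows "\<exists>R\<subseteq>S. \<forall>t. card {j \<in> S. (j \<in> R) \<noteq> (t < y j)} \<le> k"
  using assms
proof (induction k arbitrary: S)
  case 0
  then show ?case by auto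
next
  case (Suc k)
  show ?case
  proof (cases "card S \<le> 1")
    case True
    have "card {j \<in> S. (j \<in> {}) \<noteq> (t < y j)} \<le> Suc k" for t
      using card_mono[OF Suc.prems(1), of "{j \<in> S. (j \<in> {}) \<noteq> (t < y j)}"] True by auto
    then show ?thesis by blast
  next
    case False
    then obtain a b where ab: "a \<in> S" "b \<in> S" "a \<noteq> b" "y a \<le> y b"
      by (metis card_le_Suc0_iff_eq One_nat_def Suc.prems(1) linorder_linear)
    let ?T = "S - {a, b}"
    have "card ?T \<le> 2 * k"
      using Suc.prems ab by (simp add: card_Diff_subset)
    then obtain R where R: "R \<subseteq> ?T" "\<And>t. card {j \<in> ?T. (j \<in> R) \<noteq> (t < y j)} \<le> k"
      using Suc.IH[of ?T] Suc.prems(1) by auto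
    have "card {j \<in> S. (j \<in> insert b R) \<noteq> (t < y j)} \<le> Suc k" for t
    proof -
      let ?D = "{j \<in> ?T. (j \<in> R) \<noteq> (t < y j)}"
      \<comment> \<open>For each \<open>t\<close> only one element of the pair can be misplaced, and the test on \<open>y a\<close>
        names it.\<close>
      have "{j \<in> S. (j \<in> insert b R) \<noteq> (t < y j)} \<subseteq> insert (if t < y a then a else b) ?D"
        using R(1) ab by auto
      moreover have "finite ?D" using Suc.prems(1) by simp
      ultimately have "card {j \<in> S. (j \<in> insert b R) \<noteq> (t < y j)} \<le>
          card (insert (if t < y a then a else b) ?D)"
        by (intro card_mono) auto
      also have "\<dots> \<le> Suc (card ?D)"
        by (rule card_insert_le_m1) auto
      finally show ?thesis using R(2)[of t] by linarith
    qed
    moreover have "insert b R \<subseteq> S" using R(1) ab by auto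
    ultimately show ?thesis by blast
  qed
qed

text \<open>The supremum of the thresholds below \<open>h\<close> for which every index of \<open>U\<close> stays above the
  threshold.\<close>

definition reach :: "real \<Rightarrow> ('a \<Rightarrow> real) \<Rightarrow> 'a set \<Rightarrow> real" where
  "reach h y U = Min (insert h (y ` U))"

text \<open>The probability that \<open>{j \<in> I. t < y j}\<close> equals \<open>U\<close> when \<open>t\<close> is uniform in \<open>[-h, h)\<close>
  (see \<open>threshold_interval\<close>). In this closed form continuity and the antipodal symmetry are
  visible without integration. The lower end of the interval of thresholds is written as a
  reach of \<open>- y\<close>, so that negation just exchanges the two summands.\<close>

definition threshold_weight :: "'a set \<Rightarrow> real \<Rightarrow> ('a \<Rightarrow> real) \<Rightarrow> 'a set \<Rightarrow> real" where
  "threshold_weight I h y U =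
     max 0 (reach h y U + reach h (\<lambda>j. - y j) (I - U)) / (2 * h)"

lemma threshold_weight_nonneg: "0 < h \<Longrightarrow> 0 \<le> threshold_weight I h y U"
  by (simp add: threshold_weight_def)

lemma threshold_weight_complement:
  assumes "U \<subseteq> I"
  shows "threshold_weight I h (\<lambda>j. - y j) (I - U) = threshold_weight I h y U"
  using assms by (simp add: threshold_weight_def double_diff add.commute)

lemma threshold_interval:
  assumes "finite I" and "U \<subseteq> I"
  shows "{- reach h (\<lambda>j. - y j) (I - U)..<reach h y U} =
    {t. - h \<le> t \<and> t < h \<and> {j \<in> I. t < y j} = U}"
proof -
  have fin: "finite U" "finite (I - U)"
    using assms finite_subset by auto
  have "t < reach h y U \<longleftrightarrow> t < h \<and> (\<forall>j\<in>U. t < y j)" for t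
    using fin by (simp add: reach_def)
  moreover have "- reach h (\<lambda>j. - y j) (I - U) \<le> t \<longleftrightarrow> - h \<le> t \<and> (\<forall>j\<in>I - U. y j \<le> t)" for t
  proof -
    have "- reach h (\<lambda>j. - y j) (I - U) \<le> t \<longleftrightarrow> - t \<le> reach h (\<lambda>j. - y j) (I - U)" by auto
    also have "\<dots> \<longleftrightarrow> - t \<le> h \<and> (\<forall>j\<in>I - U. - t \<le> - y j)"
      using fin by (simp add: reach_def)
    finally show ?thesis by auto
  qed
  ultimately show ?thesis
    using assms(2) by (fastforce simp: not_le[symmetric])
qed

text \<open>The weights are interval lengths divided by \<open>2 * h\<close>, and the intervals partition
  \<open>[-h, h)\<close> because each threshold determines its set.\<close>

lemma sum_threshold_weight:
  assumes "finite I" and "0 < h"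
  shows "(\<Sum>U\<in>Pow I. threshold_weight I h y U) = 1"
proof -
  let ?A = "\<lambda>U. {- reach h (\<lambda>j. - y j) (I - U)..<reach h y U}"
  have len: "max 0 (reach h y U + reach h (\<lambda>j. - y j) (I - U)) = measure lborel (?A U)" for U
    by (simp add: measure_def max_def)
  have "(\<Sum>U\<in>Pow I. measure lborel (?A U)) = measure lborel (\<Union>U\<in>Pow I. ?A U)"
  proof (rule measure_finite_Union[symmetric])
    show "disjoint_family_on ?A (Pow I)"
      unfolding disjoint_family_on_def
      using threshold_interval[OF assms(1)] by auto
    show "emeasure lborel (?A U) \<noteq> \<infinity>" if "U \<in> Pow I" for U
      by (cases "- reach h (\<lambda>j. - y j) (I - U) \<le> reach h y U") auto
  qed (use assms(1) in auto)
  also have "(\<Union>U\<in>Pow I. ?A U) = (\<Union>U\<in>Pow I. {t. - h \<le> t \<and> t < h \<and> {j \<in> I. t < y j} = U})"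
    using threshold_interval[OF assms(1)] by (intro SUP_cong) auto
  also have "\<dots> = {- h..<h}" by auto
  also have "measure lborel {- h..<h} = 2 * h"
    using assms(2) by simp
  finally show ?thesis
    using assms(2) by (simp add: threshold_weight_def len sum_divide_distrib[symmetric])
qed

lemma threshold_weight_support:
  assumes "finite I" and "U \<subseteq> I" and "threshold_weight I h y U \<noteq> 0"
  obtains t where "- h \<le> t" "t < h" "U = {j \<in> I. t < y j}"
proof -
  let ?t = "- reach h (\<lambda>j. - y j) (I - U)"
  have "?t \<in> {?t..<reach h y U}"
    using assms(3) by (auto simp: threshold_weight_def max_def split: if_splits)
  then show ?thesis
    using that[of ?t] unfolding threshold_interval[OF assms(1,2)] by auto
qed

text \<open>An index whose value is not in the window is on the same side of all thresholds, so
  only the at most \<open>2 * k\<close> indices in the window have to be paired.\<close>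

lemma threshold_support_in_ball:
  assumes "finite I" and "card {j \<in> I. \<bar>y j\<bar> < h} \<le> 2 * k"
  shows "\<exists>R\<subseteq>I. \<forall>U\<subseteq>I. threshold_weight I h y U \<noteq> 0 \<longrightarrow>
    card {j \<in> I. (j \<in> R) \<noteq> (j \<in> U)} \<le> k"
proof -
  let ?S = "{j \<in> I. \<bar>y j\<bar> < h}"
  obtain R where R: "R \<subseteq> ?S" "\<And>t. card {j \<in> ?S. (j \<in> R) \<noteq> (t < y j)} \<le> k"
    using pairing_centre[of ?S k y] assms by auto
  let ?R = "R \<union> {j \<in> I. h \<le> y j}"
  have "card {j \<in> I. (j \<in> ?R) \<noteq> (j \<in> U)} \<le> k"
    if "U \<subseteq> I" "threshold_weight I h y U \<noteq> 0" for U
  proof -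
    obtain t where t: "- h \<le> t" "t < h" "U = {j \<in> I. t < y j}"
      using threshold_weight_support[OF assms(1) \<open>U \<subseteq> I\<close>] \<open>threshold_weight I h y U \<noteq> 0\<close> by blast
    have "{j \<in> I. (j \<in> ?R) \<noteq> (j \<in> U)} \<subseteq> {j \<in> ?S. (j \<in> R) \<noteq> (t < y j)}"
      using t R(1) by (auto simp: abs_less_iff)
    then have "card {j \<in> I. (j \<in> ?R) \<noteq> (j \<in> U)} \<le> card {j \<in> ?S. (j \<in> R) \<noteq> (t < y j)}"
      using assms(1) by (intro card_mono) auto
    then show ?thesis using R(2)[of t] by linarith
  qed
  moreover have "?R \<subseteq> I" using R(1) by auto
  ultimately show ?thesis by blast
qed


section \<open>A window containing few values\<close>

text \<open>The natural choice is the value of rank \<open>d + 1\<close> among the \<open>\<bar>y j\<bar>\<close>. The least average over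
  \<open>d + 1\<close> indices is not larger, hence also leaves at most \<open>d\<close> values below it; it is positive
  under the same condition, and its continuity is immediate.\<close>

definition window :: "nat \<Rightarrow> 'a set \<Rightarrow> ('a \<Rightarrow> real) \<Rightarrow> real" where
  "window d I y =
     Min ((\<lambda>J. (\<Sum>j\<in>J. \<bar>y j\<bar>) / real (Suc d)) ` {J. J \<subseteq> I \<and> card J = Suc d})"

lemma window_uminus: "window d I (\<lambda>j. - y j) = window d I y"
  by (simp add: window_def)

lemma card_window:
  assumes "finite I"
  shows "card {j \<in> I. \<bar>y j\<bar> < window d I y} \<le> d"
proof (rule ccontr)
  assume "\<not> ?thesis"
  then obtain J where J: "J \<subseteq> {j \<in> I. \<bar>y j\<bar> < window d I y}" "card J = Suc d" "finite J"
    using obtain_subset_with_card_n[of "Suc d" "{j \<in> I. \<bar>y j\<bar> < window d I y}"] by force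
  \<comment> \<open>An average of \<open>d + 1\<close> values below the least average would be smaller than it.\<close>
  have "(\<Sum>j\<in>J. \<bar>y j\<bar>) < (\<Sum>j\<in>J. window d I y)"
    using J by (intro sum_strict_mono) auto
  then have "(\<Sum>j\<in>J. \<bar>y j\<bar>) / real (Suc d) < window d I y"
    using J by (simp add: field_simps del: of_nat_Suc)
  moreover have "window d I y \<le> (\<Sum>j\<in>J. \<bar>y j\<bar>) / real (Suc d)"
    unfolding window_def using assms J by (intro Min_le) auto
  ultimately show False by linarith
qed

lemma window_pos:
  assumes "finite I" and "d < card I" and "card {j \<in> I. y j = 0} \<le> d"
  shows "0 < window d I y"
proof -
  let ?F = "{J. J \<subseteq> I \<and> card J = Suc d}"
  have ne: "?F \<noteq> {}"
    using obtain_subset_with_card_n[of "Suc d" I] assms(2) by force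
  have "0 < (\<Sum>j\<in>J. \<bar>y j\<bar>) / real (Suc d)" if J: "J \<in> ?F" for J
  proof -
    have fin: "finite J" using that assms(1) finite_subset by auto
    have "\<not> J \<subseteq> {j \<in> I. y j = 0}"
      using card_mono[of "{j \<in> I. y j = 0}" J] that assms by auto
    then obtain j where "j \<in> J" "y j \<noteq> 0" using J by auto
    then have "0 < (\<Sum>j\<in>J. \<bar>y j\<bar>)"
      using fin by (intro sum_pos2[of J j]) auto
    then show ?thesis by simp
  qed
  then show ?thesis
    unfolding window_def using ne assms(1) by simp
qed

lemma continuous_map_Min:
  fixes f :: "'i \<Rightarrow> 'a \<Rightarrow> real"
  assumes "finite I" "I \<noteq> {}" and "\<And>i. i \<in> I \<Longrightarrow> continuous_map X euclideanreal (f i)"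
  shows "continuous_map X euclideanreal (\<lambda>x. Min ((\<lambda>i. f i x) ` I))"
  using assms
proof (induction rule: finite_ne_induct)
  case (insert i F)
  then show ?case by (simp add: continuous_map_real_min)
qed simp


section \<open>Polynomials of bounded degree at integer points\<close>

text \<open>The inner products of \<open>x\<close> with the points \<open>(1, j, \<dots>, j\<^sup>d)\<close> of the moment curve. These
  points are in general position: a hyperplane through the origin contains at most \<open>d\<close> of them,
  because a nonzero polynomial of degree at most \<open>d\<close> has at most \<open>d\<close> roots.\<close>

definition poly_values :: "nat \<Rightarrow> (nat \<Rightarrow> real) \<Rightarrow> nat \<Rightarrow> real" where
  "poly_values d x j = (\<Sum>i\<le>d. x i * real j ^ i)"

lemma poly_values_uminus: "poly_values d (\<lambda>i. - x i) = (\<lambda>j. - poly_values d x j)"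
  by (simp add: poly_values_def sum_negf fun_eq_iff)

lemma card_zero_poly_values:
  assumes "x \<in> topspace (nsphere d)"
  shows "card {j \<in> {..<n}. poly_values d x j = 0} \<le> d"
proof -
  have "\<exists>i\<le>d. x i \<noteq> 0"
    using assms by (force simp: nsphere intro: ccontr)
  then obtain i where i: "i \<le> d" "x i \<noteq> 0" by blast
  let ?Z = "{z. (\<Sum>i\<le>d. x i * z ^ i) = 0}"
  have Z: "finite ?Z" "card ?Z \<le> d"
    using polyfun_rootbound[of d x] i by auto
  have "card {j \<in> {..<n}. poly_values d x j = 0} = card (real ` {j \<in> {..<n}. poly_values d x j = 0})"
    by (simp add: card_image)
  also have "\<dots> \<le> card ?Z"
    using Z(1) by (intro card_mono) (auto simp: poly_values_def)
  finally show ?thesis using Z(2) by linarith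
qed


section \<open>The equivariant map\<close>

definition sphere_weight :: "nat \<Rightarrow> nat \<Rightarrow> (nat \<Rightarrow> real) \<Rightarrow> nat set \<Rightarrow> real" where
  "sphere_weight d n x =
     threshold_weight {..<n} (window d {..<n} (poly_values d x)) (poly_values d x)"

lemma window_poly_values_pos:
  assumes "x \<in> topspace (nsphere d)" and "d < n"
  shows "0 < window d {..<n} (poly_values d x)"
  using assms card_zero_poly_values by (intro window_pos) auto

lemma continuous_map_sphere_weight:
  assumes "d < n" and "U \<subseteq> {..<n}"
  shows "continuous_map (nsphere d) euclideanreal (\<lambda>x. sphere_weight d n x U)"
proof -
  let ?h = "\<lambda>x. window d {..<n} (poly_values d x)"
  have coord: "continuous_map (nsphere d) euclideanreal (\<lambda>x. x i)" for i
    by (rule continuous_map_nsphere_projection)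
  have val: "continuous_map (nsphere d) euclideanreal (\<lambda>x. poly_values d x j)" for j
    unfolding poly_values_def
    by (intro continuous_map_sum continuous_map_real_mult coord) auto
  have ne: "{J. J \<subseteq> {..<n} \<and> card J = Suc d} \<noteq> {}"
    using obtain_subset_with_card_n[of "Suc d" "{..<n}"] assms(1) by force
  have h: "continuous_map (nsphere d) euclideanreal ?h"
    unfolding window_def
    by (intro continuous_map_Min continuous_map_real_divide continuous_map_sum
        continuous_map_real_abs val ne) (auto intro: finite_subset)
  have reach: "continuous_map (nsphere d) euclideanreal (\<lambda>x. reach (?h x) (y x) V)"
    if "finite V" and y: "\<And>j. continuous_map (nsphere d) euclideanreal (\<lambda>x. y x j)"
    for V and y :: "(nat \<Rightarrow> real) \<Rightarrow> nat \<Rightarrow> real"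
  proof -
    \<comment> \<open>The bound \<open>?h x\<close> is made the value at an extra index \<open>None\<close>, so that the reach
      becomes a minimum over a fixed finite index set.\<close>
    have "(\<lambda>x. reach (?h x) (y x) V) =
        (\<lambda>x. Min ((\<lambda>i. (case i of None \<Rightarrow> ?h x | Some j \<Rightarrow> y x j)) ` insert None (Some ` V)))"
      by (simp add: reach_def image_image)
    moreover have "continuous_map (nsphere d) euclideanreal
        (\<lambda>x. Min ((\<lambda>i. (case i of None \<Rightarrow> ?h x | Some j \<Rightarrow> y x j)) ` insert None (Some ` V)))"
      using that h by (intro continuous_map_Min) auto
    ultimately show ?thesis by (simp only:)
  qed
  have "finite U" using assms(2) finite_subset by blast
  then have upper: "continuous_map (nsphere d) euclideanreal
      (\<lambda>x. reach (?h x) (poly_values d x) U)"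
    by (rule reach[OF _ val])
  have lower: "continuous_map (nsphere d) euclideanreal
      (\<lambda>x. reach (?h x) (\<lambda>j. - poly_values d x j) ({..<n} - U))"
    by (rule reach) (auto intro: continuous_map_minus val)
  have "2 * ?h x \<noteq> 0" if "x \<in> topspace (nsphere d)" for x
    using window_poly_values_pos[OF that assms(1)] by simp
  then show ?thesis
    unfolding sphere_weight_def threshold_weight_def
    by (intro continuous_map_real_divide continuous_map_real_max continuous_map_add
        continuous_map_real_mult upper lower h) auto
qed

definition true_positions :: "bool list \<Rightarrow> nat set" where
  "true_positions u = {i. i < length u \<and> u ! i}"

lemma bij_betw_true_positions: "bij_betw true_positions (cube n) (Pow {..<n})"
proof (rule bij_betwI[where g = "\<lambda>U. map (\<lambda>i. i \<in> U) [0..<n]"])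
  show "true_positions \<in> cube n \<rightarrow> Pow {..<n}"
    by (auto simp: true_positions_def cube_def)
qed (auto simp: true_positions_def cube_def intro!: nth_equalityI)

lemma hamming_dist_true_positions:
  assumes "u \<in> cube n" and "v \<in> cube n"
  shows "hamming_dist u v =
    card {i \<in> {..<n}. (i \<in> true_positions u) \<noteq> (i \<in> true_positions v)}"
  using assms unfolding hamming_dist_def cube_def true_positions_def
  by (intro arg_cong[where f = card]) auto

text \<open>The negative copy of \<open>u\<close> gets the weight of \<open>u\<close> at \<open>- x\<close>, which is the weight of its
  antipode at \<open>x\<close>. Defined this way, equivariance holds by definition. One row serves for
  both halves of the support, since being within distance \<open>k\<close> of the antipode of \<open>u\<close> means being
  at distance at least \<open>n - k\<close> from \<open>u\<close>.\<close>

lemma equivariant_sphere_map_GHD: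
  assumes "2 * k < n"
  shows "\<exists>f. equivariant_sphere_map (2 * k) (sign_complex (cube n) (cube n) (GHD k n)) swap_sign f"
proof -
  let ?d = "2 * k"
  let ?K = "sign_complex (cube n) (cube n) (GHD k n)"
  let ?w = "\<lambda>x u. if u \<in> cube n then sphere_weight ?d n x (true_positions u) / 2 else 0"
  let ?neg = "\<lambda>x i. - x i :: real"
  define f where "f x = case_sum (?w x) (?w (?neg x))" for x :: "nat \<Rightarrow> real"
  have cube_sub: "true_positions u \<subseteq> {..<n}" if "u \<in> cube n" for u
    using that bij_betw_true_positions[of n] by (auto dest: bij_betwE)
  have fin: "finite (cube n)"
    using bij_betw_finite[OF bij_betw_true_positions[of n]] by simp
  have neg: "?neg x \<in> topspace (nsphere ?d)" if "x \<in> topspace (nsphere ?d)" for x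
    using that by (simp add: nsphere)
  have nonneg: "0 \<le> ?w x u" if "x \<in> topspace (nsphere ?d)" for x u
    unfolding sphere_weight_def
    using threshold_weight_nonneg[OF window_poly_values_pos[OF that assms]] by auto
  have total: "(\<Sum>u\<in>cube n. ?w x u) = 1 / 2" if "x \<in> topspace (nsphere ?d)" for x
  proof -
    have "(\<Sum>u\<in>cube n. ?w x u) = (\<Sum>u\<in>cube n. sphere_weight ?d n x (true_positions u)) / 2"
      by (simp add: sum_divide_distrib)
    also have "(\<Sum>u\<in>cube n. sphere_weight ?d n x (true_positions u)) =
        (\<Sum>U\<in>Pow {..<n}. sphere_weight ?d n x U)"
      by (rule sum.reindex_bij_betw[OF bij_betw_true_positions])
    also have "\<dots> = 1"
      unfolding sphere_weight_def
      using window_poly_values_pos[OF that assms] by (intro sum_threshold_weight) auto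
    finally show ?thesis .
  qed
  have sum1: "(\<Sum>v | f x v \<noteq> 0. f x v) = 1" if x: "x \<in> topspace (nsphere ?d)" for x
  proof -
    have "(\<Sum>v | f x v \<noteq> 0. f x v) = (\<Sum>v\<in>cube n <+> cube n. f x v)"
    proof (rule sum.mono_neutral_left)
      show "{v. f x v \<noteq> 0} \<subseteq> cube n <+> cube n"
      proof
        fix v
        assume "v \<in> {v. f x v \<noteq> 0}"
        then show "v \<in> cube n <+> cube n"
          by (cases v) (auto simp: f_def split: if_splits)
      qed
    qed (use fin in auto)
    also have "\<dots> = (\<Sum>u\<in>cube n. ?w x u) + (\<Sum>u\<in>cube n. ?w (?neg x) u)"
      using fin by (simp add: sum.Plus f_def cong: sum.cong)
    finally show ?thesis using total[OF x] total[OF neg[OF x]] by simp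
  qed
  have simplex: "{v. f x v \<noteq> 0} \<in> ?K" if x: "x \<in> topspace (nsphere ?d)" for x
  proof -
    let ?y = "poly_values ?d x" and ?h = "window ?d {..<n} (poly_values ?d x)"
    have few: "card {j \<in> {..<n}. \<bar>?y j\<bar> < ?h} \<le> 2 * k"
      by (rule card_window) simp
    from threshold_support_in_ball[OF finite_lessThan few]
    obtain R where R: "R \<subseteq> {..<n}"
      "\<And>U. U \<subseteq> {..<n} \<Longrightarrow> sphere_weight ?d n x U \<noteq> 0 \<Longrightarrow>
        card {j \<in> {..<n}. (j \<in> R) \<noteq> (j \<in> U)} \<le> k"
      unfolding sphere_weight_def by blast
    have "R \<in> true_positions ` cube n"
      using bij_betw_imp_surj_on[OF bij_betw_true_positions[of n]] R(1) by simp
    then obtain r where r: "r \<in> cube n" "true_positions r = R" by blast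
    have pos: "hamming_dist r u \<le> k" if "u \<in> cube n" "?w x u \<noteq> 0" for u
      using R(2)[of "true_positions u"] that cube_sub r
      by (simp add: hamming_dist_true_positions)
    have opp: "n - k \<le> hamming_dist r u" if u: "u \<in> cube n" "?w (?neg x) u \<noteq> 0" for u
    proof -
      let ?U = "true_positions u"
      let ?A = "{j \<in> {..<n}. (j \<in> R) \<noteq> (j \<in> {..<n} - ?U)}"
      let ?B = "{j \<in> {..<n}. (j \<in> R) \<noteq> (j \<in> ?U)}"
      have "sphere_weight ?d n (?neg x) ?U = sphere_weight ?d n x ({..<n} - ?U)"
        using threshold_weight_complement[of "{..<n} - ?U" "{..<n}" ?h ?y] cube_sub[OF u(1)]
        by (simp add: sphere_weight_def poly_values_uminus window_uminus double_diff)
      then have "card ?A \<le> k"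
        using R(2)[of "{..<n} - ?U"] u by simp
      moreover have "card (?A \<union> ?B) = card ?A + card ?B"
        by (rule card_Un_disjoint) auto
      moreover have "?A \<union> ?B = {..<n}" by auto
      ultimately show ?thesis
        using u r by (simp add: hamming_dist_true_positions)
    qed
    have "{v. f x v \<noteq> 0} \<subseteq> sigma_plus (cube n) (GHD k n) r"
    proof
      fix v assume v: "v \<in> {v. f x v \<noteq> 0}"
      show "v \<in> sigma_plus (cube n) (GHD k n) r"
      proof (cases v)
        case (Inl u)
        then show ?thesis
          using v pos[of u] by (auto simp: f_def sigma_plus_def GHD_def split: if_splits)
      next
        case (Inr u)
        then show ?thesis
          using v opp[of u] assms by (auto simp: f_def sigma_plus_def GHD_def split: if_splits)
      qed
    qed
    then show ?thesis using r by (auto simp: sign_complex_def)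
  qed
  have "continuous_map (nsphere ?d) euclideanreal (\<lambda>x. ?w x u)" for u
    using continuous_map_sphere_weight[OF assms cube_sub]
    by (cases "u \<in> cube n") (auto intro!: continuous_map_real_divide)
  note cont_w = this
  have cont_neg: "continuous_map (nsphere ?d) (nsphere ?d) ?neg"
  proof -
    have "continuous_map (nsphere ?d) (powertop_real UNIV) ?neg"
      by (auto simp: continuous_map_componentwise_UNIV
          intro!: continuous_map_minus continuous_map_nsphere_projection)
    then show ?thesis
      using neg by (auto simp: continuous_map_in_subtopology nsphere)
  qed
  have "continuous_map (nsphere ?d) euclideanreal (\<lambda>x. f x v)" for v
    using cont_w continuous_map_compose[OF cont_neg cont_w]
    by (cases v) (auto simp: f_def o_def)
  then have "continuous_map (nsphere ?d) (realization ?K) f"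
    unfolding realization_def continuous_map_in_subtopology continuous_map_componentwise_UNIV
    using nonneg neg simplex sum1
    by (auto simp: realization_points_def f_def split: sum.splits)
  moreover have "f (?neg x) = induced_action swap_sign (f x)" for x
    by (auto simp: f_def induced_action_def fun_eq_iff split: sum.splits)
  ultimately show ?thesis
    unfolding equivariant_sphere_map_def by blast
qed

section \<open>The coindex of the gap Hamming distance matrix\<close>

theorem theorem4:
  shows "\<exists>\<epsilon> :: nat \<Rightarrow> real. \<epsilon> \<longlonglongrightarrow> 0 \<and>
    (\<forall>k n :: nat. 1 \<le> k \<and> real k < real n / 2 \<longrightarrow>
      ereal_of_enat (coind_Z2 (sign_complex (cube n) (cube n) (GHD k n)) swap_sign)
        \<ge> ereal ((1 - \<epsilon> k) * (2 * real k)))"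
proof (intro exI[of _ "\<lambda>_. 0"] conjI allI impI)
  fix k n :: nat
  assume "1 \<le> k \<and> real k < real n / 2"
  then have "2 * k < n" by linarith
  then have "enat (2 * k) \<le> coind_Z2 (sign_complex (cube n) (cube n) (GHD k n)) swap_sign"
    unfolding coind_Z2_def by (intro Sup_upper) (use equivariant_sphere_map_GHD in blast)
  then have "ereal_of_enat (enat (2 * k)) \<le>
      ereal_of_enat (coind_Z2 (sign_complex (cube n) (cube n) (GHD k n)) swap_sign)"
    by (simp only: ereal_of_enat_le_iff)
  then show "ereal ((1 - 0) * (2 * real k)) \<le>
      ereal_of_enat (coind_Z2 (sign_complex (cube n) (cube n) (GHD k n)) swap_sign)"
    by simp
qed simp

end
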